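(* Let $F_k(x)$ denote the Fibonacci polynomials, defined by $F_1(x)=1$, $F_2(x)=x$, and $F_k(x)=xF_{k-1}(x)+F_{k-2}(x)$ for $k\ge3$. Then for every complex number $x$ for which the denominator below is nonzero, $$e^x=\dfrac{\displaystyle\sum_{k=1}^\infty\frac{F_k(x)}{k!}}{\displaystyle\sum_{k=1}^\infty(-1)^{k+1}\frac{F_k(x)}{k!}}.$$
   Context: For $x^2+4\neq0$ the Fibonacci polynomials satisfy $F_k(x)=\dfrac{(x+\sqrt{x^2+4})^k-(x-\sqrt{x^2+4})^k}{2^k\sqrt{x^2+4}}$. *)

theory Defs
  imports Complex_Main "HOL-Computational_Algebra.Polynomial"
begin

text \<open>The sequence is extended by \<open>F\<^sub>0 = 0\<close>, the unique value for which the recurrence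
  also produces \<open>F\<^sub>2\<close>; the facts below recover the definition with initial values
  \<open>F\<^sub>1 = 1\<close> and \<open>F\<^sub>2 = x\<close>.\<close>

fun fib_poly :: "nat \<Rightarrow> 'a::comm_ring_1 poly" where
  "fib_poly 0 = 0"
| "fib_poly (Suc 0) = 1"
| "fib_poly (Suc (Suc n)) = [:0, 1:] * fib_poly (Suc n) + fib_poly n"

lemma fib_poly_1: "fib_poly 1 = 1"
  by simp

lemma fib_poly_2: "fib_poly 2 = [:0, 1:]"
  by (simp add: numeral_2_eq_2)

lemma fib_poly_rec:
  assumes "k \<ge> 3"
  shows "fib_poly k = [:0, 1:] * fib_poly (k - 1) + fib_poly (k - 2)"
proof -
  from assms obtain n where "k = Suc (Suc n)"
    by (metis Suc_le_D numeral_3_eq_3 Suc_le_mono)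
  then show ?thesis
    by simp
qed

end

theory Submission
  imports Defs
begin

text \<open>Let \<open>a\<close>, \<open>b\<close> be the roots of \<open>z\<^sup>2 = x z + 1\<close>, so \<open>a + b = x\<close>. By Binet's formula the exponential
  generating function of \<open>F\<^sub>k(x)\<close> is \<open>G(t) = (e\<^bsup>at\<^esup> - e\<^bsup>bt\<^esup>) / (a - b)\<close>, or \<open>t e\<^bsup>at\<^esup>\<close> if \<open>a = b\<close>. In both
  cases \<open>G(1) = - e\<^bsup>a+b\<^esup> G(-1)\<close>, and the two series are \<open>G(1)\<close> and \<open>-G(-1)\<close>.\<close>

text \<open>Since \<open>a * b = -1\<close>, both \<open>a\<close> and \<open>b\<close> satisfy z^2
  = (a + b) z + 1, so their powers obey the Fibonacci recurrence. Multiplying by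
  \<open>a - b\<close> avoids division and keeps the identity valid in any commutative ring.\<close>

lemma fib_poly_Binet:
  fixes a b :: "'a::comm_ring_1"
  assumes "a * b = -1"
  shows "(a - b) * poly (fib_poly k) (a + b) = a ^ k - b ^ k"
proof (induction k rule: fib_poly.induct)
  case (3 n)
  have "(a - b) * poly (fib_poly (Suc (Suc n))) (a + b)
      = (a + b) * ((a - b) * poly (fib_poly (Suc n)) (a + b))
        + (a - b) * poly (fib_poly n) (a + b)"
    by (simp add: algebra_simps)
  also have "\<dots> = (a + b) * (a ^ Suc n - b ^ Suc n) + (a ^ n - b ^ n)"
    using 3 by simp
  \<comment> \<open>The cross terms are collected into a multiple of \<open>a * b + 1\<close>, which
    vanishes by assumption.\<close>
  also have "\<dots> = a ^ Suc (Suc n) - b ^ Suc (Suc n) + (a * b + 1) * (a ^ n - b ^ n)"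
    by (simp add: algebra_simps)
  finally show ?case
    using assms by simp
qed simp_all

text \<open>At a double root Binet's formula degenerates to 0 = 0; its replacement is the limit of
  (a^k - b^k) / (a - b) as b tends to a. The index \<open>Suc k\<close> avoids the exponent k -
  1.\<close>

lemma fib_poly_double_root:
  fixes a :: "'a::comm_ring_1"
  assumes "a * a = -1"
  shows "poly (fib_poly (Suc k)) (a + a) = of_nat (Suc k) * a ^ k"
proof (induction k rule: fib_poly.induct)
  case (3 n)
  have "poly (fib_poly (Suc (Suc (Suc n)))) (a + a)
      = (a + a) * (of_nat (Suc (Suc n)) * a ^ Suc n) + of_nat (Suc n) * a ^ n"
    using 3 by simp
  \<comment> \<open>The coefficient 2(n + 2) of a^(n+2) is split as (n + 3) + (n + 1).\<close>
  also have "\<dots> = of_nat (Suc (Suc (Suc n))) * (a * a) * a ^ n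
      + of_nat (Suc n) * (a * a + 1) * a ^ n"
    by (simp add: algebra_simps)
  also have "a * a + 1 = 0"
    using assms by simp
  finally show ?case
    by (simp only: mult_zero_right mult_zero_left add_0_right mult.assoc power_Suc)
qed simp_all

lemma exp_sums_divide: "(\<lambda>n. z ^ n / fact n) sums exp z"
  for z :: "'a::{real_normed_field,banach}"
  using exp_converges[of z] by (simp add: scaleR_conv_of_real divide_inverse mult.commute)

lemma fib_poly_egf:
  fixes a b t :: "'a::{real_normed_field,banach}"
  assumes "a * b = -1" "a \<noteq> b"
  shows "(\<lambda>k. t ^ k * (poly (fib_poly k) (a + b) / fact k))
           sums ((exp (t * a) - exp (t * b)) / (a - b))"
proof -
  have "poly (fib_poly k) (a + b) = (a ^ k - b ^ k) / (a - b)" for k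
    using fib_poly_Binet[OF assms(1), of k] assms(2) by (simp add: field_simps)
  then have "t ^ k * (poly (fib_poly k) (a + b) / fact k)
      = ((t * a) ^ k / fact k - (t * b) ^ k / fact k) / (a - b)" for k
    by (simp add: power_mult_distrib right_diff_distrib diff_divide_distrib mult.commute)
  then show ?thesis
    by (simp only:) (intro sums_divide sums_diff exp_sums_divide)
qed

lemma fib_poly_egf_double_root:
  fixes a t :: "'a::{real_normed_field,banach}"
  assumes "a * a = -1"
  shows "(\<lambda>k. t ^ k * (poly (fib_poly k) (a + a) / fact k)) sums (t * exp (t * a))"
proof -
  \<comment> \<open>The factor \<open>Suc k\<close> cancels against \<open>fact (Suc k)\<close>,
    leaving t times an exponential series.\<close>
  have "t ^ Suc k * (poly (fib_poly (Suc k)) (a + a) / fact (Suc k))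
      = t * ((t * a) ^ k / fact k)" for k
    unfolding fib_poly_double_root[OF assms] fact_Suc
    by (simp add: power_mult_distrib del: of_nat_Suc)
  then have "(\<lambda>k. t ^ Suc k * (poly (fib_poly (Suc k)) (a + a) / fact (Suc k)))
      sums (t * exp (t * a))"
    by (simp only:) (intro sums_mult exp_sums_divide)
  then show ?thesis
    by (subst (asm) sums_Suc_iff) simp
qed

text \<open>Hiding the closed form behind \<open>G\<close> confines the case split on
  \<open>a = b\<close> to this lemma. For distinct roots, multiplying e^(-a) - e^(-b) by e^(a+b)
  swaps the two exponentials, which gives the sign.\<close>

lemma fib_poly_egf_reflection:
  fixes x :: complex
  obtains G where
    "\<And>t. (\<lambda>k. t ^ k * (poly (fib_poly k) x / fact k)) sums G t"
    "G 1 = - (exp x * G (-1))"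
proof -
  define a where "a = (x + csqrt (x\<^sup>2 + 4)) / 2"
  define b where "b = (x - csqrt (x\<^sup>2 + 4)) / 2"
  have x: "x = a + b"
    by (simp add: a_def b_def field_simps)
  have "a * b = (x\<^sup>2 - (csqrt (x\<^sup>2 + 4))\<^sup>2) / 4"
    by (simp add: a_def b_def field_simps power2_eq_square)
  then have ab: "a * b = -1"
    by simp
  show thesis
  proof (cases "a = b")
    case True
    then have "a * a = -1"
      using ab by simp
    from fib_poly_egf_double_root[OF this] show thesis
      by (rule that[unfolded x True[symmetric]]) (simp flip: exp_add)
  next
    case False
    show thesis
      by (rule that[unfolded x, OF fib_poly_egf[OF ab False]])
         (use False in \<open>simp add: exp_add exp_minus field_simps\<close>)
  qed
qed

theorem theorem2:
  fixes x :: complex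
  shows "summable (\<lambda>k. poly (fib_poly (Suc k)) x / fact (Suc k)) \<and>
         summable (\<lambda>k. (-1) ^ (Suc k + 1) * (poly (fib_poly (Suc k)) x / fact (Suc k))) \<and>
         ((\<Sum>k. (-1) ^ (Suc k + 1) * (poly (fib_poly (Suc k)) x / fact (Suc k))) \<noteq> 0 \<longrightarrow>
          exp x = (\<Sum>k. poly (fib_poly (Suc k)) x / fact (Suc k)) /
                  (\<Sum>k. (-1) ^ (Suc k + 1) * (poly (fib_poly (Suc k)) x / fact (Suc k))))"
proof -
  obtain G where G: "\<And>t. (\<lambda>k. t ^ k * (poly (fib_poly k) x / fact k)) sums G t"
    and refl: "G 1 = - (exp x * G (-1))"
    using fib_poly_egf_reflection by blast
  have shifted: "(\<lambda>k. t ^ Suc k * (poly (fib_poly (Suc k)) x / fact (Suc k))) sums G t" for t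
    using G[of t] by (subst sums_Suc_iff) simp
  have num: "(\<lambda>k. poly (fib_poly (Suc k)) x / fact (Suc k)) sums G 1"
    using shifted[of 1] by (simp only: power_one mult_1)
  \<comment> \<open>The sign (-1)^(k+1) is -(-1)^k, so this is minus the series at t = -1.\<close>
  have den: "(\<lambda>k. (-1) ^ (Suc k + 1) * (poly (fib_poly (Suc k)) x / fact (Suc k)))
      sums (- G (-1))"
    using sums_minus[OF shifted[of "-1"]]
    by (simp only: add_Suc_right add_0_right One_nat_def power_Suc mult_minus_left mult_1)
  show ?thesis
    using sums_summable[OF num] sums_summable[OF den]
    unfolding sums_unique[OF num, symmetric] sums_unique[OF den, symmetric] refl
    by simp
qed

end
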